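(* Let $\mathcal{T} = \{1, 2, 2^2, 2^3, \dots\}\subseteq \mathbb{Z}$ and let $S \subseteq \mathbb{Z}_{\leq -1}$ be the infinite set defined in the context. Write $S = \{-x_1, -x_2, -x_3, \dots\}$ where $x_1 < x_2 < x_3 < \cdots$. Define $S_1 = S$ and for each integer $i \geq 1$ define $$S_{i+1} := \begin{cases} S_i \setminus \{-x_i\} & \text{if } (S_i \setminus \{-x_i\}) + \mathcal{T} = \mathbb{Z},\\ S_i & \text{otherwise.}\end{cases}$$ Let $\mathcal{S} = \bigcap_{i\geq 1} S_i$. Then $(\mathcal{S}, \mathcal{T})$ is a co-minimal pair in $\mathbb{Z}$.
   Context: For nonempty subsets $A, B$ of an abelian group $(G,+)$, write $A + B = \{a+b \mid a\in A, b\in B\}$, and $x + A = \{x\} + A$, $A - x = A + \{-x\}$ for $x \in G$. The pair $(A,B)$ is called a co-minimal pair in $G$ if $A + B = G$, $A' + B \subsetneq G$ for every $\emptyset \neq A' \subsetneq A$, and $A + B' \subsetneq G$ for every $\emptyset \neq B' \subsetneq B$. Definition of $S$. Define subsets $J_n, K_n, I_n$ ($n \geq 0$) of $\mathbb{Z}$ by $J_0 = \{1\}$, $J_1 = \{1\}$, $J_n = \{1, 2, \dots, 2^{n-2}\} \cup (2^{n-1} + J_{n-1})$ for $n \geq 2$; $K_0 = J_0$, $K_1 = J_1$, $K_2 = J_2 \setminus \{1\}$, $K_n = \{2^{n-3}+1, 2^{n-3}+2, \dots, 2^{n-2}\} \cup (2^{n-1} + 2^{n-2} + J_{n-2})$ for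 $n \geq 3$; $I_n = K_n - (1 + 2^{n+1})$ for $n \geq 0$. Then $S = \bigcup_{n\geq 0} I_n$. *)

theory Defs
  imports Complex_Main "HOL-Library.Set_Algebras" "HOL-Library.Infinite_Set"
begin

text \<open>Throughout, \<open>A + B\<close> on sets is the sumset from \<open>Set_Algebras\<close>,
  whereas \<open>A - B\<close> is set difference; translates are written as images.\<close>

definition co_minimal_pair :: "'a::ab_group_add set \<Rightarrow> 'a set \<Rightarrow> bool" where
  "co_minimal_pair A B \<longleftrightarrow>
     A \<noteq> {} \<and> B \<noteq> {} \<and>
     A + B = UNIV \<and>
     (\<forall>A'. A' \<noteq> {} \<and> A' \<subset> A \<longrightarrow> A' + B \<subset> UNIV) \<and>
     (\<forall>B'. B' \<noteq> {} \<and> B' \<subset> B \<longrightarrow> A + B' \<subset> UNIV)"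

text \<open>In the last equation \<open>n = m + 2\<close>, so \<open>2^m\<close> is \<open>2^(n-2)\<close> and \<open>2^(Suc m)\<close> is \<open>2^(n-1)\<close>.\<close>

fun J_set :: "nat \<Rightarrow> int set" where
  "J_set 0 = {1}"
| "J_set (Suc 0) = {1}"
| "J_set (Suc (Suc m)) = {1..2 ^ m} \<union> (\<lambda>j. 2 ^ Suc m + j) ` J_set (Suc m)"

definition K_set :: "nat \<Rightarrow> int set" where
  "K_set n =
     (if n \<le> 1 then J_set n
      else if n = 2 then J_set 2 - {1}
      else {2 ^ (n - 3) + 1..2 ^ (n - 2)} \<union>
           (\<lambda>j. 2 ^ (n - 1) + 2 ^ (n - 2) + j) ` J_set (n - 2))"

definition I_set :: "nat \<Rightarrow> int set" where
  "I_set n = (\<lambda>k. k - (1 + 2 ^ (n + 1))) ` K_set n"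

definition S_set :: "int set" where
  "S_set = (\<Union>n. I_set n)"

definition T_set :: "int set" where
  "T_set = range (\<lambda>k::nat. 2 ^ k)"

text \<open>\<open>S_set\<close> is an infinite set of negative integers, so its increasing
  enumeration of absolute values exists and is unique.\<close>

lemma J_set_bounds: "J_set n \<subseteq> {1..2 ^ n}"
proof (induction n rule: J_set.induct)
  case (3 m)
  have "(1::int) \<le> 2 ^ m" by simp
  with 3 show ?case by (fastforce simp: algebra_simps)
qed auto

lemma J_set_nonempty: "J_set n \<noteq> {}"
  by (induction n rule: J_set.induct) auto

lemma K_set_bounds: "K_set n \<subseteq> {1..2 ^ n}"
proof (cases "n \<le> 2")
  case True
  then have "K_set n \<subseteq> J_set n"
    by (cases "n = 2") (auto simp: K_set_def)
  then show ?thesis using J_set_bounds by blast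
next
  case False
  then obtain m where n: "n = m + 3"
    by (metis add.commute le_Suc_ex not_less_eq_eq numeral_2_eq_2 numeral_3_eq_3)
  have "(1::int) \<le> 2 ^ m" by simp
  then show ?thesis
    using J_set_bounds[of "m + 1"] unfolding K_set_def n
    by (fastforce simp: power_add algebra_simps)
qed

lemma K_set_nonempty: "K_set n \<noteq> {}"
proof (cases "n = 2")
  case True
  then show ?thesis by (auto simp: K_set_def numeral_2_eq_2)
next
  case False
  then show ?thesis using J_set_nonempty by (auto simp: K_set_def)
qed

lemma I_set_bounds: "I_set n \<subseteq> {- (2 ^ (n + 1))..- (2 ^ n) - 1}"
  using K_set_bounds[of n] by (fastforce simp: I_set_def)

lemma S_set_negative: "S_set \<subseteq> {..-1}"
proof
  fix s assume "s \<in> S_set"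
  then obtain n where "s \<in> I_set n" by (auto simp: S_set_def)
  then have "s \<le> - (2 ^ n) - 1" using I_set_bounds by fastforce
  moreover have "(0::int) \<le> 2 ^ n" by simp
  ultimately show "s \<in> {..-1}" unfolding atMost_iff by linarith
qed

lemma infinite_S_set: "infinite S_set"
proof
  assume "finite S_set"
  then obtain b where b: "\<And>s. s \<in> S_set \<Longrightarrow> b \<le> s"
    by (metis Min_le)
  define n where "n = nat (- b)"
  obtain s where s: "s \<in> I_set n"
    using K_set_nonempty[of n] by (auto simp: I_set_def)
  then have "s \<le> - (2 ^ n) - 1" using I_set_bounds by fastforce
  moreover have "int n < 2 ^ n" by (metis of_nat_less_two_power)
  moreover have "b \<le> s" using s b by (auto simp: S_set_def)
  ultimately show False unfolding n_def by linarith
qed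

lemma S_set_enumeration_exists:
  "\<exists>x::nat \<Rightarrow> int. strict_mono_on {1..} x \<and> S_set = {- x i | i. i \<ge> 1}"
proof -
  define X where "X = (\<lambda>s. nat (- s)) ` S_set"
  have "inj_on (\<lambda>s. nat (- s)) S_set"
    using S_set_negative by (fastforce simp: inj_on_def)
  then have inf: "infinite X"
    unfolding X_def using infinite_S_set finite_image_iff by blast
  define x where "x = (\<lambda>i. int (enumerate X (i - 1)))"
  have "strict_mono_on {1..} x"
    using inf by (auto simp: x_def intro!: strict_mono_onI enumerate_mono)
  moreover have "S_set = {- x i | i. i \<ge> 1}"
  proof -
    have "S_set = (\<lambda>m. - int m) ` X"
    proof -
      have "- int (nat (- s)) = s" if "s \<in> S_set" for s
        using that S_set_negative by fastforce
      then show ?thesis unfolding X_def image_image by (metis (no_types, lifting) image_cong image_ident)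
    qed
    also have "\<dots> = (\<lambda>m. - int m) ` range (enumerate X)"
      using range_enumerate[OF inf] by simp
    also have "\<dots> = {- x i | i. i \<ge> 1}"
    proof -
      have "- int (enumerate X k) = - x (Suc k)" for k by (simp add: x_def)
      then show ?thesis by (force simp: x_def)
    qed
    finally show ?thesis .
  qed
  ultimately show ?thesis by blast
qed

end

theory Submission
  imports Defs
begin

text \<open>
  Greedy deletion makes the first summand minimal by construction: an element that survives
  was found to be indispensable at its own stage, hence also later. Two things can go wrong.
  A number with infinitely many representations \<open>s + 2 ^ k\<close> may lose all of them, one at a time,
  although no single stage uncovers it; and a power of \<open>2\<close> may be superfluous. Both are settled
  by numbers that have exactly one representation in \<open>S_set + T_set\<close>: the element
  used there is never deleted, and the power used there is needed.

  These numbers are visible in binary. Replace every integer \<open>z\<close> by its bitwise complement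
  \<open>- 1 - z\<close>; a representation of \<open>z\<close> becomes an exponent \<open>k\<close> with \<open>(- 1 - z) + 2 ^ k\<close> in the
  image of \<open>S_set\<close>. With \<open>*\<close> for an arbitrary, possibly empty, block of binary digits, that image
  (\<open>complement_S_iff\<close>) consists of \<open>1\<close>, of \<open>11\<close> and all \<open>10...01\<close>, of all \<open>1110*\<close>, and of all
  \<open>10...011*\<close> in which at least two zeros follow the leading \<open>1\<close>.

  The leading digits of an integer then show how to cover it (\<open>representation_exists\<close>). The only
  integers \<open>w\<close> with infinitely many exponents are \<open>1\<close> and those whose binary expansion begins with
  \<open>11\<close>, because only these may be the tail of arbitrarily long elements. But for \<open>w = 11*\<close>
  the number \<open>10w\<close>, that is \<open>1011*\<close>, has \<open>100w\<close> as its only representing element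
  (\<open>unique_exponent_ge_3\<close>). So \<open>100w\<close> is never deleted, and it also represents
  \<open>w\<close>. As the block \<open>11*\<close> varies, the same uniqueness shows that every power from \<open>2 ^ 3\<close>
  on is needed; \<open>1\<close>, \<open>2\<close> and \<open>4\<close> have the witnesses \<open>2\<close>, \<open>36\<close> and \<open>5\<close>.
\<close>

section \<open>Greedy deletion\<close>

text \<open>
  The limit of a decreasing sequence of sets that all cover need not cover. It does at \<open>z\<close> if
  \<open>z\<close> has finitely many representations, since some stage has lost all those that are ever lost,
  or if some representation of \<open>z\<close> uses an element without which even the
  initial set fails to cover. Minimality of the limit holds because the element \<open>- x i\<close> survives
  only if stage \<open>i\<close>, which contains the limit, fails to cover without it.
\<close>

lemma greedy_deletion:
  fixes x :: "nat \<Rightarrow> 'a::ab_group_add" and S :: "nat \<Rightarrow> 'a set"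
  assumes enum: "A = {- x i | i. i \<ge> 1}"
    and S_1: "S 1 = A"
    and S_step: "\<And>i. i \<ge> 1 \<Longrightarrow>
      S (i + 1) = (if (S i - {- x i}) + T = UNIV then S i - {- x i} else S i)"
    and cover: "A + T = UNIV"
    and fin: "\<And>z. finite {t \<in> T. z - t \<in> A} \<or>
      (\<exists>t\<in>T. z - t \<in> A \<and> (A - {z - t}) + T \<noteq> UNIV)"
  shows "(\<Inter>i\<in>{1..}. S i) + T = UNIV"
    and "\<And>A'. A' \<subset> (\<Inter>i\<in>{1..}. S i) \<Longrightarrow> A' + T \<noteq> UNIV"
proof -
  have dec: "S (i + 1) \<subseteq> S i" if "i \<ge> 1" for i
    using S_step[OF that] by auto
  have anti: "S j \<subseteq> S i" if "1 \<le> i" "i \<le> j" for i j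
    using that(2)
  proof (induction rule: dec_induct)
    case (step n)
    then show ?case using dec[of n] that(1) by auto
  qed simp
  have sub: "S i \<subseteq> A" if "i \<ge> 1" for i
    using anti[of 1 i] S_1 that by simp
  have cov: "S i + T = UNIV" if "i \<ge> 1" for i
    using that
  proof (induction rule: dec_induct)
    case base
    show ?case using cover S_1 by simp
  next
    case (step n)
    then show ?case using S_step[of n] by simp
  qed
  have essential: "a \<in> S i" if a: "a \<in> A" "(A - {a}) + T \<noteq> UNIV" and "i \<ge> 1" for a i
  proof (rule ccontr)
    assume "a \<notin> S i"
    then have "S i \<subseteq> A - {a}" using sub[OF \<open>i \<ge> 1\<close>] by blast
    then have "S i + T \<subseteq> (A - {a}) + T" by (rule set_plus_mono2) simp
    then show False using cov[OF \<open>i \<ge> 1\<close>] a(2) by auto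
  qed
  show "(\<Inter>i\<in>{1..}. S i) + T = UNIV"
  proof -
    have "z \<in> (\<Inter>i\<in>{1..}. S i) + T" for z
    proof -
      have "\<exists>t\<in>T. \<forall>i\<ge>1. z - t \<in> S i"
        using fin[of z]
      proof
        assume F: "finite {t \<in> T. z - t \<in> A}"
        show ?thesis
        proof (rule ccontr)
          assume "\<not> ?thesis"
          then obtain d where d: "\<And>t. t \<in> T \<Longrightarrow> d t \<ge> 1 \<and> z - t \<notin> S (d t)" by metis
          define N where "N = Max (insert 1 (d ` {t \<in> T. z - t \<in> A}))"
          have N: "N \<ge> 1" "\<And>t. t \<in> T \<Longrightarrow> z - t \<in> A \<Longrightarrow> d t \<le> N"
            unfolding N_def using F by auto
          obtain s t where st: "s \<in> S N" "t \<in> T" "z = s + t"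
            using cov[OF N(1)] by (metis UNIV_I set_plus_elim)
          then have "z - t \<in> S N" by simp
          moreover have "d t \<le> N" using N(2)[OF st(2)] sub[OF N(1)] calculation by blast
          ultimately show False using d[OF st(2)] anti[of "d t" N] by blast
        qed
      next
        assume "\<exists>t\<in>T. z - t \<in> A \<and> (A - {z - t}) + T \<noteq> UNIV"
        then show ?thesis using essential by blast
      qed
      then obtain t where "t \<in> T" "z - t \<in> (\<Inter>i\<in>{1..}. S i)" by auto
      then have "(z - t) + t \<in> (\<Inter>i\<in>{1..}. S i) + T" by (intro set_plus_intro)
      then show ?thesis by simp
    qed
    then show ?thesis by blast
  qed
  show "A' + T \<noteq> UNIV" if A': "A' \<subset> (\<Inter>i\<in>{1..}. S i)" for A'
  proof
    assume U: "A' + T = UNIV"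
    obtain a where a: "a \<notin> A'" "\<And>i. i \<ge> 1 \<Longrightarrow> a \<in> S i"
      using A' by blast
    then have "a \<in> A" using sub[of 1] by blast
    then obtain i where i: "i \<ge> 1" "a = - x i" using enum by blast
    have "A' \<subseteq> S i - {- x i}" using A' a(1) i by blast
    then have "A' + T \<subseteq> (S i - {- x i}) + T" by (rule set_plus_mono2) simp
    then have "(S i - {- x i}) + T = UNIV" using U by auto
    then have "a \<notin> S (i + 1)" using S_step[OF i(1)] i(2) by simp
    then show False using a(2) by simp
  qed
qed

section \<open>The binary shape of the complement\<close>

text \<open>
  The map \<open>u \<mapsto> - 1 - u\<close> is bitwise negation in two's complement. It turns the negative set into a
  set of positive integers, each block \<open>I_set n\<close> becoming the elements with top bit \<open>2 ^ n\<close>.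
\<close>

definition complement_S :: "int set" where
  "complement_S = {u. - 1 - u \<in> S_set}"

text \<open>
  Unfolding the recursion peels off one leading digit at a time. Either the two leading digits
  of the reflected number \<open>r\<close> are \<open>11\<close>, or its leading digit is \<open>0\<close> and the recursion
  continues below it.
\<close>

lemma J_set_complement:
  "2 ^ Suc m - r \<in> J_set (Suc m) \<longleftrightarrow>
     r = 1 \<or> (\<exists>i. i + 1 \<le> m \<and> 3 * 2 ^ i \<le> r \<and> r < 4 * 2 ^ i)"
proof (induction m)
  case 0
  then show ?case by auto
next
  case (Suc m)
  have "2 ^ Suc (Suc m) - r \<in> J_set (Suc (Suc m)) \<longleftrightarrow>
      3 * 2 ^ m \<le> r \<and> r < 4 * 2 ^ m \<or> 2 ^ Suc m - r \<in> J_set (Suc m)"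
    by (force simp: image_iff algebra_simps)
  also have "\<dots> \<longleftrightarrow> r = 1 \<or> (\<exists>i. i + 1 \<le> Suc m \<and> 3 * 2 ^ i \<le> r \<and> r < 4 * 2 ^ i)"
    unfolding Suc.IH by (auto simp: le_Suc_eq)
  finally show ?case .
qed

lemma nat_cases_3:
  fixes n :: nat
  obtains "n = 0" | "n = 1" | "n = 2" | m where "n = m + 3"
proof -
  have "n = 0 \<or> n = 1 \<or> n = 2 \<or> n = (n - 3) + 3" by arith
  then show thesis using that by blast
qed

lemma top_bit_unique:
  fixes u :: int
  assumes "2 ^ m \<le> u" "u < 2 ^ Suc m" "2 ^ n \<le> u" "u < 2 ^ Suc n"
  shows "m = n"
proof -
  have "(2::int) ^ m < 2 ^ Suc n" "(2::int) ^ n < 2 ^ Suc m" using assms by linarith+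
  then have "m < Suc n" "n < Suc m" by (simp_all del: power_Suc)
  then show ?thesis by simp
qed

lemma top_bit_exists:
  fixes u :: int
  assumes "u \<ge> 1"
  obtains n where "2 ^ n \<le> u" "u < 2 ^ Suc n"
proof -
  have "\<exists>n. 2 ^ n \<le> nat u \<and> nat u < 2 ^ (n + 1)"
    using ex_power_ivl1[of 2 "nat u"] assms by simp
  then obtain n where "2 ^ n \<le> nat u" "nat u < 2 ^ (n + 1)" by blast
  then have "2 ^ n \<le> u" "u < 2 ^ Suc n"
    using assms by (simp_all add: le_nat_iff nat_less_iff)
  then show ?thesis by (rule that)
qed

text \<open>
  For \<open>n \<ge> 3\<close> the last case is the interval in \<open>K_set n\<close>: with \<open>2 ^ n\<close> added it reads \<open>1110*\<close>. The
  other cases come from the shifted copy of \<open>J_set\<close>, and two zeros are forced after the top digit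
  because that copy is \<open>J_set (n - 2)\<close>.
\<close>

lemma complement_S_iff:
  assumes r: "0 \<le> r" "r < 2 ^ n"
  shows "2 ^ n + r \<in> complement_S \<longleftrightarrow>
     n = 0 \<and> r = 0 \<or> n \<ge> 1 \<and> r = 1 \<or>
     (\<exists>i. i + 4 \<le> n \<and> 3 * 2 ^ i \<le> r \<and> r < 4 * 2 ^ i) \<or>
     (\<exists>i. n = i + 3 \<and> 6 * 2 ^ i \<le> r \<and> r < 7 * 2 ^ i)"
proof -
  have "- 1 - (2 ^ n + r) \<in> S_set \<longleftrightarrow> - 1 - (2 ^ n + r) \<in> I_set n"
  proof
    assume "- 1 - (2 ^ n + r) \<in> S_set"
    then obtain m where m: "- 1 - (2 ^ n + r) \<in> I_set m" by (auto simp: S_set_def)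
    then have "2 ^ m \<le> 2 ^ n + r" "2 ^ n + r < 2 ^ Suc m"
      using I_set_bounds[of m] by fastforce+
    then have "m = n" using top_bit_unique[of m "2 ^ n + r" n] r by simp
    then show "- 1 - (2 ^ n + r) \<in> I_set n" using m by simp
  qed (auto simp: S_set_def)
  also have "\<dots> \<longleftrightarrow> 2 ^ n - r \<in> K_set n"
    by (force simp: I_set_def image_iff algebra_simps)
  finally have *: "2 ^ n + r \<in> complement_S \<longleftrightarrow> 2 ^ n - r \<in> K_set n"
    by (simp add: complement_S_def)
  consider "n = 0" | "n = 1" | "n = 2" | m where "n = m + 3"
    by (rule nat_cases_3)
  then show ?thesis
  proof cases
    case 4
    have "2 ^ n - r \<in> K_set n \<longleftrightarrow>
        6 * 2 ^ m \<le> r \<and> r < 7 * 2 ^ m \<or> 2 ^ Suc m - r \<in> J_set (Suc m)"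
      unfolding K_set_def 4 by (force simp: image_iff power_add algebra_simps)
    then show ?thesis unfolding * J_set_complement using 4 by auto
  qed (use * in \<open>auto simp: K_set_def numeral_2_eq_2\<close>)
qed

lemma mem_S_T_iff: "z \<in> S_set + T_set \<longleftrightarrow> (\<exists>k. (- 1 - z) + 2 ^ k \<in> complement_S)"
proof
  assume "z \<in> S_set + T_set"
  then obtain s k where "s \<in> S_set" "z = s + 2 ^ k"
    by (auto simp: T_set_def elim!: set_plus_elim)
  then have "(- 1 - z) + 2 ^ k \<in> complement_S" by (simp add: complement_S_def)
  then show "\<exists>k. (- 1 - z) + 2 ^ k \<in> complement_S" ..
next
  assume "\<exists>k. (- 1 - z) + 2 ^ k \<in> complement_S"
  then obtain k where "z - 2 ^ k \<in> S_set" by (auto simp: complement_S_def)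
  then have "(z - 2 ^ k) + 2 ^ k \<in> S_set + T_set"
    by (intro set_plus_intro) (auto simp: T_set_def)
  then show "z \<in> S_set + T_set" by simp
qed

section \<open>Every integer is covered\<close>

text \<open>
  The exponent is read off from the leading digits. A negative \<open>w\<close>, whose infinite expansion
  begins \<open>...1110\<close>, is cut off to \<open>1110*\<close>. If \<open>w > 3\<close> and \<open>w = 11*\<close>, a \<open>1\<close> is put far enough to the left.
  If \<open>w = 10*\<close>, let \<open>r\<close> be \<open>w\<close> without its top bit: when \<open>r\<close> is \<open>1\<close> or begins with \<open>11\<close>,
  doubling the top bit inserts the missing zero; otherwise \<open>r\<close> is \<open>0\<close> or begins with
  \<open>10\<close>, and a \<open>1\<close> is added inside \<open>r\<close> to give \<open>1\<close> or \<open>11*\<close>. The last device leaves too few zeros for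
  \<open>w = 1010*\<close>, which instead is raised to \<open>1110*\<close>.
\<close>

lemma representation_exists: "\<exists>k. w + 2 ^ k \<in> complement_S"
proof -
  have one: "1 \<in> complement_S" using complement_S_iff[of 0 0] by simp
  consider "w \<le> - 2" | "w = - 1" | "w = 0" | "w \<ge> 1" by linarith
  then show ?thesis
  proof cases
    case 1
    then obtain m where m: "2 ^ m \<le> - w - 1" "- w - 1 < 2 ^ Suc m"
      using top_bit_exists[of "- w - 1"] by auto
    \<comment> \<open>The target \<open>w + 2 ^ (m + 4)\<close> is \<open>1110*\<close>; its top bit \<open>2 ^ (m + 3)\<close> is split off.\<close>
    have "2 ^ (m + 3) + (w + 8 * 2 ^ m) \<in> complement_S"
      using m by (subst complement_S_iff) (auto simp: power_add)
    then have "w + 2 ^ (m + 4) \<in> complement_S" by (simp add: power_add algebra_simps)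
    then show ?thesis ..
  next
    case 2
    then have "w + 2 ^ 1 \<in> complement_S" using one by simp
    then show ?thesis ..
  next
    case 3
    then have "w + 2 ^ 0 \<in> complement_S" using one by simp
    then show ?thesis ..
  next
    case 4
    then obtain m where m: "2 ^ m \<le> w" "w < 2 ^ Suc m"
      using top_bit_exists[of w] by auto
    define r where "r = w - 2 ^ m"
    have r: "0 \<le> r" "r < 2 ^ m" "w = 2 ^ m + r" using m by (auto simp: r_def)
    consider "r = 1" | "r = 0" | "r \<ge> 2" "m \<ge> 2" using r
      by (cases m rule: J_set.cases) force+
    then show ?thesis
    proof cases
      case 1
      then have "2 ^ Suc m + r \<in> complement_S" using r by (subst complement_S_iff) auto
      then have "w + 2 ^ m \<in> complement_S" using r by (simp add: algebra_simps)
      then show ?thesis ..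
    next
      case 2
      show ?thesis
      proof (cases "m = 0")
        case True
        have "2 ^ 1 + 1 \<in> complement_S" by (subst complement_S_iff) auto
        then have "w + 2 ^ 1 \<in> complement_S" using r 2 True by simp
        then show ?thesis ..
      next
        case False
        have "2 ^ m + 1 \<in> complement_S" using False by (subst complement_S_iff) auto
        then have "w + 2 ^ 0 \<in> complement_S" using r 2 by simp
        then show ?thesis ..
      qed
    next
      case 3
      then obtain l where l: "m = Suc l" by (cases m) auto
      show ?thesis
      proof (cases "r \<ge> 2 ^ l")
        case True
        have "2 ^ (l + 4) + w \<in> complement_S"
          using r True by (subst complement_S_iff) (auto simp: l power_add)
        then have "w + 2 ^ (l + 4) \<in> complement_S" by (simp add: add.commute)
        then show ?thesis ..
      next
        case False
        obtain j' where j': "2 ^ j' \<le> r" "r < 2 ^ Suc j'"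
          using top_bit_exists[of r] 3 by auto
        with 3 obtain j where j: "j' = Suc j" by (cases j') auto
        have "(2::int) ^ j' < 2 ^ l" using j' False by linarith
        then have "j' < l" by (rule power_less_imp_less_exp[rotated]) simp
        then have jl: "j + 2 \<le> l" by (simp add: j)
        show ?thesis
        proof (cases "3 * 2 ^ j \<le> r")
          case True
          have "2 ^ Suc m + r \<in> complement_S"
            using r True j' jl by (subst complement_S_iff) (auto simp: l j intro!: exI[of _ j])
          then have "w + 2 ^ m \<in> complement_S" using r by (simp add: algebra_simps)
          then show ?thesis ..
        next
          case F3: False
          show ?thesis
          proof (cases "j + 3 \<le> l")
            case True
            have "(2::int) ^ (j + 3) \<le> 2 ^ l" using True by (intro power_increasing) auto
            then have "2 ^ m + (r + 2 ^ j) \<in> complement_S"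
              using r j' F3 True
              by (subst complement_S_iff) (auto simp: l j power_add intro!: exI[of _ j])
            then have "w + 2 ^ j \<in> complement_S" using r by (simp add: algebra_simps)
            then show ?thesis ..
          next
            case False
            then have l2: "l = j + 2" using jl by simp
            \<comment> \<open>Here \<open>w = 1010*\<close>, and \<open>2 ^ l\<close> is the weight of its second digit.\<close>
            have "2 ^ m + (r + 2 ^ l) \<in> complement_S"
              using r j' F3
              by (subst complement_S_iff) (auto simp: l l2 j power_add)
            then have "w + 2 ^ l \<in> complement_S" using r by (simp add: algebra_simps)
            then show ?thesis ..
          qed
        qed
      qed
    qed
  qed
qed

section \<open>Numbers with a unique representation\<close>

text \<open>
  If \<open>w = 10*\<close> had an exponent beyond its top bit, then \<open>w\<close> would be what follows the leading
  digit of an element; but that is \<open>0\<close>, \<open>1\<close> or begins with \<open>11\<close>. So only the finitely many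
  exponents up to the top bit have to be examined.
\<close>

lemma leading_bits_10:
  assumes w: "2 ^ Suc m \<le> w" "w < 3 * 2 ^ m" and u: "w + 2 ^ k \<in> complement_S"
  shows "2 ^ k \<le> w"
proof (rule ccontr)
  assume "\<not> 2 ^ k \<le> w"
  have "(1::int) \<le> 2 ^ m" by simp
  then have "2 \<le> w" using w by simp
  with \<open>\<not> 2 ^ k \<le> w\<close> consider i where "3 * 2 ^ i \<le> w" "w < 4 * 2 ^ i"
    | i where "6 * 2 ^ i \<le> w" "w < 7 * 2 ^ i"
    using u complement_S_iff[of w k] by (auto simp: add.commute)
  then show False
  proof cases
    case 1
    then have "Suc i = Suc m" using w by (intro top_bit_unique[of _ w]) auto
    then show False using 1 w by simp
  next
    case 2
    then have "i + 2 = Suc m" using w by (intro top_bit_unique[of _ w]) auto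
    then have "m = Suc i" by simp
    then show False using 2 w by simp
  qed
qed

text \<open>
  Here \<open>w = 1011*\<close>. The exponent \<open>j + 3\<close> doubles the top bit and gives \<open>10011*\<close>; smaller ones
  keep the top bit and leave a remainder that is at least \<open>11*\<close>, too large for an element with
  two zeros after the top digit, while \<open>1110*\<close> is missed.
\<close>

lemma unique_exponent_ge_3:
  assumes w: "11 * 2 ^ j \<le> w" "w < 12 * 2 ^ j" and u: "w + 2 ^ k \<in> complement_S"
  shows "k = j + 3"
proof (rule ccontr)
  assume "k \<noteq> j + 3"
  have pos: "(1::int) \<le> 2 ^ j" by simp
  have "2 ^ k \<le> w"
    using leading_bits_10[of "j + 2" w k] w u by (simp add: power_add)
  then have "(2::int) ^ k < 2 ^ (j + 4)" using w by (simp add: power_add)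
  then have "k < j + 4" by (rule power_less_imp_less_exp[rotated]) simp
  then have k: "k \<le> j + 1 \<or> k = j + 2" using \<open>k \<noteq> j + 3\<close> by linarith
  define r where "r = w + 2 ^ k - 2 ^ (j + 3)"
  have "(2::int) ^ k \<le> 2 ^ (j + 1)" if "k \<le> j + 1"
    using that by (intro power_increasing) auto
  moreover have "(0::int) < 2 ^ k" "(2::int) ^ (j + 1) = 2 * 2 ^ j"
    "(2::int) ^ (j + 2) = 4 * 2 ^ j" "(2::int) ^ (j + 3) = 8 * 2 ^ j"
    by (simp_all add: power_add)
  \<comment> \<open>The exponent \<open>j + 2\<close> overshoots \<open>1110*\<close> into \<open>1111*\<close>; smaller ones do not reach it.\<close>
  ultimately have r: "3 * 2 ^ j \<le> r" "r < 6 * 2 ^ j \<or> 7 * 2 ^ j \<le> r" "r < 2 ^ (j + 3)"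
    using w k unfolding r_def by (auto; linarith)+
  have "2 ^ (j + 3) + r \<in> complement_S" using u by (simp add: r_def)
  then consider "r = 1" | i where "i + 1 \<le> j" "r < 4 * 2 ^ i"
    using complement_S_iff[of r "j + 3"] r pos by auto
  then show False
  proof cases
    case 2
    have "(2::int) ^ (i + 1) \<le> 2 ^ j" using 2 by (intro power_increasing) auto
    then show False using 2 r pos by simp
  qed (use r pos in simp)
qed

text \<open>
  These are all the sums \<open>2 + 2 ^ k\<close>, \<open>36 + 2 ^ k\<close> and \<open>5 + 2 ^ k\<close> that remain to be excluded
  once \<open>k\<close> is bounded by the top bit of the first summand. The sums that do occur are
  \<open>3\<close>, \<open>38\<close> (in binary \<open>100110\<close>) and \<open>9\<close>.
\<close>

lemma small_numbers_not_in_complement_S: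
  "4 \<notin> complement_S" "6 \<notin> complement_S" "7 \<notin> complement_S"
  "37 \<notin> complement_S" "40 \<notin> complement_S" "44 \<notin> complement_S"
  "52 \<notin> complement_S" "68 \<notin> complement_S"
proof -
  have n2: "\<not> i + 4 \<le> (2::nat)" "(2::nat) \<noteq> i + 3" for i by simp_all
  have n5: "(\<exists>i. i + 4 \<le> (5::nat) \<and> P i) \<longleftrightarrow> P 0 \<or> P 1"
    "(\<exists>i. (5::nat) = i + 3 \<and> P i) \<longleftrightarrow> P 2" for P
  proof -
    have "i + 4 \<le> (5::nat) \<longleftrightarrow> i = 0 \<or> i = 1" "(5::nat) = i + 3 \<longleftrightarrow> i = 2" for i by auto
    then show "(\<exists>i. i + 4 \<le> (5::nat) \<and> P i) \<longleftrightarrow> P 0 \<or> P 1"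
      "(\<exists>i. (5::nat) = i + 3 \<and> P i) \<longleftrightarrow> P 2" by metis+
  qed
  have n6: "(\<exists>i. i + 4 \<le> (6::nat) \<and> P i) \<longleftrightarrow> P 0 \<or> P 1 \<or> P 2"
    "(\<exists>i. (6::nat) = i + 3 \<and> P i) \<longleftrightarrow> P 3" for P
  proof -
    have "i + 4 \<le> (6::nat) \<longleftrightarrow> i = 0 \<or> i = 1 \<or> i = 2" "(6::nat) = i + 3 \<longleftrightarrow> i = 3" for i by auto
    then show "(\<exists>i. i + 4 \<le> (6::nat) \<and> P i) \<longleftrightarrow> P 0 \<or> P 1 \<or> P 2"
      "(\<exists>i. (6::nat) = i + 3 \<and> P i) \<longleftrightarrow> P 3" by metis+
  qed
  show "4 \<notin> complement_S" "6 \<notin> complement_S" "7 \<notin> complement_S"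
    using complement_S_iff[of 0 2] complement_S_iff[of 2 2] complement_S_iff[of 3 2]
    unfolding n2 by simp_all
  show "37 \<notin> complement_S" "40 \<notin> complement_S" "44 \<notin> complement_S" "52 \<notin> complement_S"
    using complement_S_iff[of 5 5] complement_S_iff[of 8 5]
      complement_S_iff[of 12 5] complement_S_iff[of 20 5]
    unfolding n5 by simp_all
  show "68 \<notin> complement_S"
    using complement_S_iff[of 4 6] unfolding n6 by simp
qed

lemma unique_exponent_0:
  assumes "2 + 2 ^ k \<in> complement_S" shows "k = 0"
proof -
  have "(2::int) ^ k \<le> 2" using leading_bits_10[of 0 2 k] assms by simp
  then have "(2::int) ^ k < 2 ^ 2" by simp
  then have "k < 2" by (rule power_less_imp_less_exp[rotated]) simp
  then show ?thesis using assms small_numbers_not_in_complement_S by (auto simp: less_2_cases_iff)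
qed

lemma unique_exponent_1:
  assumes "36 + 2 ^ k \<in> complement_S" shows "k = 1"
proof -
  have "(2::int) ^ k \<le> 36" using leading_bits_10[of 4 36 k] assms by simp
  then have "(2::int) ^ k < 2 ^ 6" by simp
  then have "k < 6" by (rule power_less_imp_less_exp[rotated]) simp
  then have "k \<in> {0, 1, 2, 3, 4, 5}" by auto
  then show ?thesis using assms small_numbers_not_in_complement_S by auto
qed

lemma unique_exponent_2:
  assumes "5 + 2 ^ k \<in> complement_S" shows "k = 2"
proof -
  have "(2::int) ^ k \<le> 5" using leading_bits_10[of 1 5 k] assms by simp
  then have "(2::int) ^ k < 2 ^ 3" by simp
  then have "k < 3" by (rule power_less_imp_less_exp[rotated]) simp
  then have "k \<in> {0, 1, 2}" by auto
  then show ?thesis using assms small_numbers_not_in_complement_S by auto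
qed

lemma every_power_is_needed: "\<exists>w. \<forall>l. w + 2 ^ l \<in> complement_S \<longrightarrow> l = k"
proof -
  consider "k = 0" | "k = 1" | "k = 2" | j where "k = j + 3"
    by (rule nat_cases_3)
  then show ?thesis
  proof cases
    case 4
    then show ?thesis
      using unique_exponent_ge_3[of j "11 * 2 ^ j"] by (intro exI[of _ "11 * 2 ^ j"]) auto
  qed (use unique_exponent_0 unique_exponent_1 unique_exponent_2 in blast)+
qed

section \<open>Finitely many representations or an indispensable one\<close>

text \<open>
  For negative \<open>w\<close> and large \<open>k\<close> the sum \<open>w + 2 ^ k\<close> begins with \<open>1111\<close>, which no element
  does.
\<close>

lemma finite_exponents_negative:
  assumes "w \<le> - 1"
  shows "finite {k. w + 2 ^ k \<in> complement_S}"
proof -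
  obtain n where n: "- w \<le> 2 ^ n"
    using top_bit_exists[of "- w"] assms by (metis le_minus_iff order_less_imp_le)
  have "k < n + 4" if k: "w + 2 ^ k \<in> complement_S" for k
  proof (rule ccontr)
    assume "\<not> k < n + 4"
    then obtain l where l: "k = l + 4" "n \<le> l"
      by (metis add.commute add_le_cancel_right le_Suc_ex le_add2 not_le order_trans)
    have "(2::int) ^ n \<le> 2 ^ l" using l by (intro power_increasing) auto
    then have w: "- w \<le> 2 ^ l" using n by linarith
    define r where "r = w + 8 * 2 ^ l"
    have r: "7 * 2 ^ l \<le> r" "r < 2 ^ (l + 3)" using w assms by (auto simp: r_def power_add)
    have pos: "(1::int) \<le> 2 ^ l" by simp
    have "2 ^ (l + 3) + r \<in> complement_S" using k by (simp add: r_def l power_add algebra_simps)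
    then obtain i where "i + 1 \<le> l" "r < 4 * 2 ^ i"
      using complement_S_iff[of r "l + 3"] r pos by auto
    moreover have "(2::int) ^ (i + 1) \<le> 2 ^ l" 
      using calculation by (intro power_increasing) auto
    ultimately show False using r pos by simp
  qed
  then show ?thesis by (meson finite_nat_set_iff_bounded mem_Collect_eq)
qed

text \<open>
  A negative \<open>w\<close> and a \<open>w\<close> that begins with \<open>10\<close> have finitely many exponents, and \<open>0\<close> has
  one. For the others, the number \<open>v\<close> has only one representing element, and that element also
  represents \<open>w\<close>.
  If \<open>w = 1\<close> the element is \<open>3\<close>, with \<open>v = 2\<close>; if \<open>w = 11*\<close> it is \<open>100w\<close>, with \<open>v = 10w\<close>.
\<close>

lemma finite_or_essential:
  "finite {k. w + 2 ^ k \<in> complement_S} \<or>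
   (\<exists>k. w + 2 ^ k \<in> complement_S \<and>
     (\<exists>v. \<forall>l. v + 2 ^ l \<in> complement_S \<longrightarrow> v + 2 ^ l = w + 2 ^ k))"
proof -
  consider "w \<le> - 1" | "w = 0" | "w = 1" | "w \<ge> 2" by linarith
  then show ?thesis
  proof cases
    case 1
    then show ?thesis using finite_exponents_negative by blast
  next
    case 2
    have "{k. w + 2 ^ k \<in> complement_S} \<subseteq> {0}" using complement_S_iff[of 0] 2 by auto
    then show ?thesis using finite_subset by blast
  next
    case 3
    have "2 ^ 1 + 1 \<in> complement_S" by (subst complement_S_iff) auto
    then have "w + 2 ^ 1 \<in> complement_S" using 3 by simp
    moreover have "\<forall>l. 2 + 2 ^ l \<in> complement_S \<longrightarrow> 2 + 2 ^ l = w + 2 ^ 1"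
      using unique_exponent_0 3 by fastforce
    ultimately show ?thesis by blast
  next
    case 4
    then obtain m' where m': "2 ^ m' \<le> w" "w < 2 ^ Suc m'" using top_bit_exists[of w] by auto
    with 4 obtain m where m: "m' = Suc m" by (cases m') auto
    show ?thesis
    proof (cases "w < 3 * 2 ^ m")
      case True
      have "k < Suc m'" if "w + 2 ^ k \<in> complement_S" for k
      proof -
        have "2 ^ k \<le> w" using leading_bits_10[of m w k] that True m' m by simp
        then have "(2::int) ^ k < 2 ^ Suc m'" using m' by linarith
        then show ?thesis by (rule power_less_imp_less_exp[rotated]) simp
      qed
      then show ?thesis by (meson finite_nat_set_iff_bounded mem_Collect_eq)
    next
      case False
      have "2 ^ (m + 4) + w \<in> complement_S"
        using False m' m by (subst complement_S_iff) (auto simp: power_add)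
      then have "w + 2 ^ (m + 4) \<in> complement_S" by (simp add: add.commute)
      moreover have "(w + 2 ^ (m + 3)) + 2 ^ l = w + 2 ^ (m + 4)"
        if "(w + 2 ^ (m + 3)) + 2 ^ l \<in> complement_S" for l
      proof -
        have "l = m + 3"
          using unique_exponent_ge_3[of m "w + 2 ^ (m + 3)" l] that False m' m
          by (simp add: power_add)
        then show ?thesis by (simp add: power_add)
      qed
      ultimately show ?thesis by blast
    qed
  qed
qed

section \<open>Co-minimality\<close>

theorem theorem2p3:
  fixes x :: "nat \<Rightarrow> int" and S :: "nat \<Rightarrow> int set"
  assumes x_mono: "strict_mono_on {1..} x"
    and x_enum: "S_set = {- x i | i. i \<ge> 1}"
    and S_1: "S 1 = S_set"
    and S_step: "\<And>i. i \<ge> 1 \<Longrightarrow>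
      S (i + 1) = (if (S i - {- x i}) + T_set = UNIV then S i - {- x i} else S i)"
  shows "co_minimal_pair (\<Inter>i\<in>{1..}. S i) T_set"
proof -
  let ?S = "\<Inter>i\<in>{1..}. S i"
  have sum: "S_set + T_set = UNIV"
    using representation_exists by (auto simp: mem_S_T_iff)
  have fin: "finite {t \<in> T_set. z - t \<in> S_set} \<or>
      (\<exists>t\<in>T_set. z - t \<in> S_set \<and> (S_set - {z - t}) + T_set \<noteq> UNIV)" for z
    using finite_or_essential[of "- 1 - z"]
  proof
    assume "finite {k. (- 1 - z) + 2 ^ k \<in> complement_S}"
    then have "finite ((\<lambda>k. 2 ^ k) ` {k. (- 1 - z) + 2 ^ k \<in> complement_S} :: int set)" by simp
    moreover have "{t \<in> T_set. z - t \<in> S_set} \<subseteq>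
        (\<lambda>k. 2 ^ k) ` {k. (- 1 - z) + 2 ^ k \<in> complement_S}"
      by (auto simp: T_set_def complement_S_def)
    ultimately show ?thesis using finite_subset by blast
  next
    assume "\<exists>k. (- 1 - z) + 2 ^ k \<in> complement_S \<and>
      (\<exists>v. \<forall>l. v + 2 ^ l \<in> complement_S \<longrightarrow> v + 2 ^ l = (- 1 - z) + 2 ^ k)"
    then obtain k v where k: "(- 1 - z) + 2 ^ k \<in> complement_S"
      and v: "\<And>l. v + 2 ^ l \<in> complement_S \<Longrightarrow> v + 2 ^ l = (- 1 - z) + 2 ^ k" by blast
    have "- 1 - v \<notin> (S_set - {z - 2 ^ k}) + T_set"
    proof
      assume "- 1 - v \<in> (S_set - {z - 2 ^ k}) + T_set"
      then obtain s l where s: "s \<in> S_set" "s \<noteq> z - 2 ^ k" "- 1 - v = s + 2 ^ l"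
        by (auto simp: T_set_def elim!: set_plus_elim)
      then have "s = - 1 - (v + 2 ^ l)" by simp
      moreover from this have "v + 2 ^ l = (- 1 - z) + 2 ^ k"
        using v[of l] s(1) by (simp add: complement_S_def)
      ultimately show False using s(2) by simp
    qed
    then show ?thesis
      using k by (intro disjI2 bexI[of _ "2 ^ k"]) (auto simp: complement_S_def T_set_def)
  qed
  have cover: "?S + T_set = UNIV"
    by (rule greedy_deletion(1)[where A = S_set and x = x and S = S and T = T_set],
        rule x_enum, rule S_1, erule S_step, rule sum, rule fin)
  have min: "A' + T_set \<noteq> UNIV" if "A' \<subset> ?S" for A'
    by (rule greedy_deletion(2)[where A = S_set and x = x and S = S and T = T_set],
        rule x_enum, rule S_1, erule S_step, rule sum, rule fin, rule that)
  have min_T: "?S + B' \<noteq> UNIV" if B': "B' \<subset> T_set" for B'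
  proof
    assume U: "?S + B' = UNIV"
    obtain k where k: "2 ^ k \<notin> B'" using B' by (auto simp: T_set_def)
    obtain w where w: "\<And>l. w + 2 ^ l \<in> complement_S \<Longrightarrow> l = k" using every_power_is_needed by blast
    have "- 1 - w \<in> ?S + B'" using U by simp
    then obtain s b where s: "s \<in> ?S" "b \<in> B'" "- 1 - w = s + b" by (rule set_plus_elim)
    obtain l where l: "b = 2 ^ l" using s B' by (auto simp: T_set_def)
    have "s \<in> S_set" using s(1) S_1 by force
    then have "w + 2 ^ l \<in> complement_S" using s(3) l by (simp add: complement_S_def algebra_simps)
    then show False using w k l s(2) by blast
  qed
  have "?S \<noteq> {}"
  proof
    assume "?S = {}"
    then have "?S + T_set = {}" by (simp only:) (auto elim: set_plus_elim)
    then show False using cover by simp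
  qed
  moreover have "T_set \<noteq> {}" by (simp add: T_set_def)
  ultimately show ?thesis
    unfolding co_minimal_pair_def top.not_eq_extremum[symmetric]
    by (intro conjI allI impI cover) (assumption | erule conjE, rule min min_T, assumption)+
qed

end
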